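(* Let $b\in H^\infty_1$. If $\mathscr H(b)$ admits a sampling sequence, then $b$ is an inner function.
   Context: $\mathbb D$ is the open unit disk, $\mathbb T=\partial\mathbb D$, $m$ normalized Lebesgue measure on $\mathbb T$. $H^\infty_1$ is the closed unit ball of $H^\infty$ (bounded analytic functions on $\mathbb D$ with sup norm). $b$ is inner if $|b|=1$ $m$-a.e. on $\mathbb T$. For $b\in H^\infty_1$, the de Branges–Rovnyak space $\mathscr H(b)$ is the reproducing kernel Hilbert space of analytic functions on $\mathbb D$ with reproducing kernel $k^b_\lambda(z)=\frac{1-\overline{b(\lambda)}b(z)}{1-\overline\lambda z}$ ($\lambda,z\in\mathbb D$); its norm is denoted $\|\cdot\|_b$. A sequence $(\lambda_n)_{n\ge1}\subset\mathbb D$ is a sampling sequence for $\mathscr H(b)$ if there are constants $c,C>0$ such that, for all $f\in\mathscr H(b)$, $$c\,\|f\|_b^2\le\sum_{n=1}^\infty\|k^b_{\lambda_n}\|_b^{-2}|f(\lambda_n)|^2\le C\,\|f\|_b^2.$$ *)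

theory Defs
  imports "HOL-Analysis.Analysis"
begin

section \<open>The unit ball of $H^\infty$ and inner functions\<close>

abbreviation unit_disk :: "complex set" where
  "unit_disk \<equiv> ball 0 1"

definition Hinf_unit_ball :: "(complex \<Rightarrow> complex) set" where
  "Hinf_unit_ball = {b. b holomorphic_on unit_disk \<and> (\<forall>z\<in>unit_disk. norm (b z) \<le> 1)}"

text \<open>Normalized Lebesgue measure on the unit circle, as a Borel measure on \<open>\<complex>\<close>.\<close>

definition circle_measure :: "complex measure" where
  "circle_measure = distr (uniform_measure lborel {0..<2 * pi}) borel cis"

text \<open>
  The boundary values of \<open>b\<close> are its radial limits, which exist almost everywhere for bounded
  analytic functions (Fatou). The values of the HOL function \<open>b\<close> at points of the circle
  itself are irrelevant.
\<close>

definition has_radial_limit :: "(complex \<Rightarrow> complex) \<Rightarrow> complex \<Rightarrow> complex \<Rightarrow> bool" where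
  "has_radial_limit b \<zeta> w \<longleftrightarrow> ((\<lambda>r::real. b (of_real r * \<zeta>)) \<longlongrightarrow> w) (at_left 1)"

definition inner_function :: "(complex \<Rightarrow> complex) \<Rightarrow> bool" where
  "inner_function b \<longleftrightarrow> b \<in> Hinf_unit_ball \<and>
     (AE \<zeta> in circle_measure. \<exists>w. has_radial_limit b \<zeta> w \<and> norm w = 1)"

section \<open>Reproducing kernel Hilbert spaces\<close>

definition ip_norm :: "('f \<Rightarrow> 'f \<Rightarrow> complex) \<Rightarrow> 'f \<Rightarrow> real" where
  "ip_norm ip f = sqrt (Re (ip f f))"

text \<open>
  A function on \<open>X\<close> is encoded as a total function that vanishes outside \<open>X\<close>, so that equality
  of HOL functions is equality on \<open>X\<close>. The inner product \<open>ip\<close> is linear in its first argument;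
  its values outside \<open>H\<close> are unconstrained.
\<close>

locale hilbert_function_space =
  fixes X :: "'a set"
    and H :: "('a \<Rightarrow> complex) set"
    and ip :: "('a \<Rightarrow> complex) \<Rightarrow> ('a \<Rightarrow> complex) \<Rightarrow> complex"
  assumes vanish_outside: "\<lbrakk>f \<in> H; x \<notin> X\<rbrakk> \<Longrightarrow> f x = 0"
    and zero_mem: "(\<lambda>x. 0) \<in> H"
    and add_mem: "\<lbrakk>f \<in> H; g \<in> H\<rbrakk> \<Longrightarrow> (\<lambda>x. f x + g x) \<in> H"
    and scale_mem: "f \<in> H \<Longrightarrow> (\<lambda>x. c * f x) \<in> H"
    and ip_add: "\<lbrakk>f \<in> H; g \<in> H; h \<in> H\<rbrakk> \<Longrightarrow> ip (\<lambda>x. f x + g x) h = ip f h + ip g h"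
    and ip_scale: "\<lbrakk>f \<in> H; h \<in> H\<rbrakk> \<Longrightarrow> ip (\<lambda>x. c * f x) h = c * ip f h"
    and ip_commute: "\<lbrakk>f \<in> H; g \<in> H\<rbrakk> \<Longrightarrow> ip g f = cnj (ip f g)"
    and ip_nonneg: "f \<in> H \<Longrightarrow> 0 \<le> Re (ip f f)"
    and ip_definite: "\<lbrakk>f \<in> H; ip f f = 0\<rbrakk> \<Longrightarrow> f = (\<lambda>x. 0)"
    and complete:
      "\<lbrakk>\<And>n. F n \<in> H;
        \<And>e. e > 0 \<Longrightarrow> \<exists>N. \<forall>m\<ge>N. \<forall>n\<ge>N. ip_norm ip (\<lambda>x. F m x - F n x) < e\<rbrakk>
       \<Longrightarrow> \<exists>f\<in>H. (\<lambda>n. ip_norm ip (\<lambda>x. F n x - f x)) \<longlonglongrightarrow> 0"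

text \<open>\<open>K w\<close> is the kernel function at the point \<open>w\<close>, that is \<open>K w z = k\<^sub>w(z)\<close>.\<close>

locale reproducing_kernel_hilbert_space = hilbert_function_space X H ip
  for X :: "'a set" and H ip +
  fixes K :: "'a \<Rightarrow> 'a \<Rightarrow> complex"
  assumes kernel_mem: "w \<in> X \<Longrightarrow> K w \<in> H"
    and reproducing: "\<lbrakk>f \<in> H; w \<in> X\<rbrakk> \<Longrightarrow> ip f (K w) = f w"

section \<open>De Branges--Rovnyak spaces and sampling sequences\<close>

definition dBR_kernel :: "(complex \<Rightarrow> complex) \<Rightarrow> complex \<Rightarrow> complex \<Rightarrow> complex" where
  "dBR_kernel b w z =
     (if z \<in> unit_disk then (1 - cnj (b w) * b z) / (1 - cnj w * z) else 0)"

text \<open>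
  \<open>de_Branges_Rovnyak_space b H ip\<close> says that \<open>H\<close> with inner product \<open>ip\<close> is the space
  $\mathscr{H}(b)$. A reproducing kernel determines its Hilbert space (Moore--Aronszajn), so
  \<open>H\<close>, and \<open>ip\<close> on \<open>H\<close>, are unique.
\<close>

definition de_Branges_Rovnyak_space ::
    "(complex \<Rightarrow> complex) \<Rightarrow> (complex \<Rightarrow> complex) set \<Rightarrow>
     ((complex \<Rightarrow> complex) \<Rightarrow> (complex \<Rightarrow> complex) \<Rightarrow> complex) \<Rightarrow> bool" where
  "de_Branges_Rovnyak_space b H ip \<longleftrightarrow>
     reproducing_kernel_hilbert_space unit_disk H ip (dBR_kernel b) \<and>
     (\<forall>f\<in>H. f holomorphic_on unit_disk)"

text \<open>
  The weight \<open>1 / 0 = 0\<close> can only occur when \<open>b\<close> is a unimodular constant, in which case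
  $\mathscr{H}(b)$ is trivial.
\<close>

definition sampling_sequence ::
    "(complex \<Rightarrow> complex) \<Rightarrow> (complex \<Rightarrow> complex) set \<Rightarrow>
     ((complex \<Rightarrow> complex) \<Rightarrow> (complex \<Rightarrow> complex) \<Rightarrow> complex) \<Rightarrow> (nat \<Rightarrow> complex) \<Rightarrow> bool" where
  "sampling_sequence b H ip \<Lambda> \<longleftrightarrow>
     range \<Lambda> \<subseteq> unit_disk \<and>
     (\<exists>c>0. \<exists>C>0. \<forall>f\<in>H.
        let s = (\<lambda>n. (norm (f (\<Lambda> n)))\<^sup>2 / (ip_norm ip (dBR_kernel b (\<Lambda> n)))\<^sup>2)
        in summable s \<and>
           c * (ip_norm ip f)\<^sup>2 \<le> (\<Sum>n. s n) \<and> (\<Sum>n. s n) \<le> C * (ip_norm ip f)\<^sup>2)"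

end

theory Submission
  imports Defs "HOL-Complex_Analysis.Complex_Analysis"
begin

text \<open>
  Testing the sampling inequality on \<open>k\<^sub>0\<close> shows that the weights
  \<open>v\<^sub>n = \<parallel>k\<^bsub>\<lambda>\<^sub>n\<^esub>\<parallel>\<^sup>-\<^sup>2\<close> are summable. Testing it on \<open>k\<^sub>z\<close> with \<open>z = r\<zeta>\<close> gives
  \<open>c (1 - \<bar>b(r\<zeta>)\<bar>\<^sup>2) \<le> 4 \<Sum> v\<^sub>n (1 - r\<^sup>2) / \<bar>\<zeta> - r\<lambda>\<^sub>n\<bar>\<^sup>2\<close>, and the circle mean of the right-hand side
  is \<open>4 \<Sum> v\<^sub>n (1 - r\<^sup>2) / (1 - r\<^sup>2\<bar>\<lambda>\<^sub>n\<bar>\<^sup>2)\<close>, which tends to \<open>0\<close> as \<open>r \<rightarrow> 1\<close> by dominated convergence.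
  Hence the radial limits of \<open>b\<close>, which exist almost everywhere by Fatou's theorem, are unimodular.

  Fatou's theorem is obtained from a primitive of \<open>b\<close>: it is Lipschitz on the closed disk, so its
  restriction to the circle is differentiable almost everywhere, and at each such point the
  derivative \<open>b\<close> has a radial limit, by Cauchy's formula.
\<close>

section \<open>Lipschitz functions of a real variable\<close>

text \<open>The measure with distribution function \<open>G\<close> is the image of Lebesgue measure under the inverse
  of \<open>G\<close>; it is absolutely continuous because \<open>G\<close> maps null sets to null sets.\<close>

lemma expanding_Lipschitz_has_density:
  fixes G :: "real \<Rightarrow> real"
  assumes expand: "\<And>x y. x \<le> y \<Longrightarrow> y - x \<le> G y - G x"
    and Lip: "\<And>x y. x \<le> y \<Longrightarrow> G y - G x \<le> K * (y - x)"
  obtains f where "\<And>a b. a \<le> b \<Longrightarrow> (f has_integral (G b - G a)) {a..b}"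
proof -
  have K: "K \<ge> 0" using expand[of 0 1] Lip[of 0 1] by simp
  have mono: "G x < G y" if "x < y" for x y using expand[of x y] that by simp
  have inj: "inj G" by (rule injI) (metis linorder_neqE mono less_irrefl)
  have lipG: "\<bar>G x - G y\<bar> \<le> K * \<bar>x - y\<bar>" for x y
    using Lip[of x y] Lip[of y x] expand[of x y] expand[of y x] by (cases "x \<le> y") (auto simp: abs_if)
  have contG: "continuous_on UNIV G"
    by (rule lipschitz_on_continuous_on[of K], rule lipschitz_onI) (use lipG K in \<open>auto simp: dist_real_def\<close>)
  have "\<exists>x. G x = y" for y
  proof -
    \<comment> \<open>Expansion gives \<open>G (-t)\<close> <= \<open>G 0 - t\<close> and
      \<open>G 0 + t\<close> <= \<open>G t\<close>, so going the distance |y - G 0| to either side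
      of 0 brackets \<open>y\<close> for the intermediate value theorem.\<close>
    define t where "t = \<bar>y - G 0\<bar>"
    have "G (-t) \<le> y" "y \<le> G t" using expand[of "-t" 0] expand[of 0 t] by (auto simp: t_def)
    then show ?thesis using IVT'[of G "-t" y t] contG continuous_on_subset by (force simp: t_def)
  qed
  then have surj: "surj G" by (metis surjI)
  define g where "g = inv G"
  have Gg: "G (g y) = y" and gG: "g (G x) = x" for x y
    using surj inj by (auto simp: g_def surj_f_inv_f)
  have g_le: "x \<le> g y \<longleftrightarrow> G x \<le> y" "g y \<le> x \<longleftrightarrow> y \<le> G x" for x y
    by (metis Gg mono linorder_not_le order.asym nle_le)+
  have lipg: "\<bar>g x - g y\<bar> \<le> \<bar>x - y\<bar>" for x y
    using expand[of "g x" "g y"] expand[of "g y" "g x"] Gg[of x] Gg[of y] by arith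
  have contg: "continuous_on UNIV g"
    by (rule lipschitz_on_continuous_on[of 1], rule lipschitz_onI) (use lipg in \<open>auto simp: dist_real_def\<close>)
  then have [measurable]: "g \<in> borel_measurable borel" by (rule borel_measurable_continuous_onI)
  define \<mu> where "\<mu> = distr lborel borel g"
  have icc: "emeasure \<mu> {a..b} = ennreal (G b - G a)" if "a \<le> b" for a b
  proof -
    have "g -` {a..b} = {G a..G b}" by (auto simp: g_le)
    moreover have "G a \<le> G b" using mono that by (metis order_le_less)
    ultimately show ?thesis by (simp add: \<mu>_def emeasure_distr)
  qed
  have "absolutely_continuous lborel \<mu>"
    unfolding absolutely_continuous_def
  proof
    fix A :: "real set" assume A: "A \<in> null_sets lborel"
    then have [measurable]: "A \<in> sets borel" by auto
    have "negligible A" using A by (simp add: negligible_iff_null_sets null_sets_completionI)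
    have "g -` A = G ` A" by (force simp: Gg gG image_iff)
    moreover have "negligible (G ` A)"
    proof (rule negligible_locally_Lipschitz_image[OF _ \<open>negligible A\<close>])
      fix x show "\<exists>T B. open T \<and> x \<in> T \<and> (\<forall>y\<in>A \<inter> T. norm (G y - G x) \<le> B * norm (y - x))"
        using lipG by (intro exI[of _ UNIV] exI[of _ K]) auto
    qed simp
    moreover have "g -` A \<in> sets borel" using measurable_sets[of g borel borel A] by simp
    ultimately have "g -` A \<in> null_sets lborel"
      by (metis negligible_iff_null_sets null_sets_completion_iff sets_lborel)
    then show "A \<in> null_sets \<mu>" by (auto simp: \<mu>_def null_sets_def emeasure_distr)
  qed
  then obtain f where [measurable]: "f \<in> borel_measurable borel" and f: "density lborel f = \<mu>"
    using sigma_finite_measure.Radon_Nikodym[OF lborel.sigma_finite_measure_axioms, of \<mu>] by (auto simp: \<mu>_def)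
  have nn: "(\<integral>\<^sup>+x. f x * indicator {a..b} x \<partial>lborel) = ennreal (G b - G a)" if "a \<le> b" for a b
    using icc[OF that] by (simp add: f[symmetric] emeasure_density)
  \<comment> \<open>The Radon-Nikodym density takes values in \<open>ennreal\<close>. Its integral
    over each [-n, n] is finite, so it is finite almost everywhere and passing to
    \<open>enn2real\<close> below alters it only on a null set.\<close>
  have fin: "AE x in lborel. f x \<noteq> \<infinity>"
  proof -
    have "AE x in lborel. \<forall>n::nat. f x * indicator {-real n..real n} x \<noteq> \<infinity>"
      unfolding AE_all_countable by (intro allI nn_integral_PInf_AE) (simp_all add: nn)
    then show ?thesis
    proof (rule AE_mp, intro AE_I2 impI)
      fix x :: real assume *: "\<forall>n::nat. f x * indicator {-real n..real n} x \<noteq> \<infinity>"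
      obtain n where "\<bar>x\<bar> \<le> real n" using real_arch_simple by blast
      then have "x \<in> {-real n..real n}" by auto
      then show "f x \<noteq> \<infinity>" using *[rule_format, of n] by simp
    qed
  qed
  show ?thesis
  proof
    fix a b :: real assume ab: "a \<le> b"
    have "(\<integral>\<^sup>+x. ennreal (enn2real (f x) * indicator {a..b} x) \<partial>lborel) = ennreal (G b - G a)"
      unfolding nn[OF ab, symmetric]
      by (rule nn_integral_cong_AE, rule AE_mp[OF fin])
         (auto intro!: AE_I2 simp: indicator_def less_top[symmetric])
    then have "((\<lambda>x. enn2real (f x) * indicator {a..b} x) has_integral (G b - G a)) UNIV"
      using expand[OF ab] ab by (intro nn_integral_has_integral) auto
    moreover have "(\<lambda>x. enn2real (f x) * indicator {a..b} x) = (\<lambda>x. if x \<in> {a..b} then enn2real (f x) else 0)"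
      by (auto simp: indicator_def)
    ultimately show "((\<lambda>x. enn2real (f x)) has_integral (G b - G a)) {a..b}"
      by (simp only: has_integral_restrict_UNIV)
  qed
qed

text \<open>The library's Lebesgue differentiation theorem is one-sided, so it is applied to \<open>f\<close> and to
  its reflection.\<close>

lemma indefinite_integral_differentiable:
  fixes f F :: "real \<Rightarrow> real"
  assumes F: "\<And>a b. a \<le> b \<Longrightarrow> (f has_integral (F b - F a)) {a..b}"
  obtains N where "negligible N" "\<And>x. x \<notin> N \<Longrightarrow> (F has_real_derivative f x) (at x)"
proof -
  have "f integrable_on cbox a b" for a b
    using F[of a b] by (cases "a \<le> b") (auto simp: integrable_on_def)
  then obtain N1 where N1: "negligible N1" "\<And>x e. \<lbrakk>x \<notin> N1; 0 < e\<rbrakk> \<Longrightarrow>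
      \<exists>d>0. \<forall>h. 0 < h \<and> h < d \<longrightarrow> norm (integral (cbox x (x + h *\<^sub>R One)) f /\<^sub>R h ^ DIM(real) - f x) < e"
    using integrable_ccontinuous_explicit[of f] by blast
  have F': "((\<lambda>x. f (- x)) has_integral (F (-a) - F (-b))) {a..b}" if "a \<le> b" for a b
    using F[of "-b" "-a"] that has_integral_reflect_real[where f = f and a = "-b" and b = "-a"] by simp
  then have "(\<lambda>x. f (- x)) integrable_on cbox a b" for a b
    by (cases "a \<le> b") (auto simp: integrable_on_def)
  then obtain N2 where N2: "negligible N2" "\<And>x e. \<lbrakk>x \<notin> N2; 0 < e\<rbrakk> \<Longrightarrow>
      \<exists>d>0. \<forall>h. 0 < h \<and> h < d \<longrightarrow> norm (integral (cbox x (x + h *\<^sub>R One)) (\<lambda>x. f (- x)) /\<^sub>R h ^ DIM(real) - f (- x)) < e"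
    using integrable_ccontinuous_explicit[of "\<lambda>x. f (- x)"] by blast
  show ?thesis
  proof
    show "negligible (N1 \<union> uminus ` N2)"
      using N1(1) N2(1)
      by (intro negligible_Un negligible_differentiable_image_negligible) (auto intro!: derivative_intros)
    fix x assume x: "x \<notin> N1 \<union> uminus ` N2"
    have I1: "integral {x..x + h} f = F (x + h) - F x" if "h > 0" for h
      using F[of x "x + h"] that by (auto intro: integral_unique)
    \<comment> \<open>Averages of the reflected function to the right of -x are averages of
      \<open>f\<close> over [x - h, x], that is, left difference quotients of
      \<open>F\<close>.\<close>
    have I2: "integral {- x..h - x} (\<lambda>x. f (- x)) = F x - F (x - h)" if "h > 0" for h :: real
      using F'[of "-x" "h - x"] that by (auto intro: integral_unique)
    have "- x \<notin> N2" using x by force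
    have "\<exists>d>0. \<forall>h::real. h \<noteq> 0 \<and> norm (h - 0) < d \<longrightarrow> norm ((F (x + h) - F x) / h - f x) < e" if "e > 0" for e
    proof -
      obtain d1 where d1: "d1 > 0" "\<And>h. 0 < h \<and> h < d1 \<Longrightarrow> \<bar>(F (x + h) - F x) / h - f x\<bar> < e"
        using N1(2)[of x e] x \<open>e > 0\<close> by (auto simp: I1 divide_inverse_commute)
      obtain d2 where d2: "d2 > 0" "\<And>h. 0 < h \<and> h < d2 \<Longrightarrow> \<bar>(F x - F (x - h)) / h - f x\<bar> < e"
        using N2(2)[of "-x" e] \<open>- x \<notin> N2\<close> \<open>e > 0\<close> by (auto simp: I2 divide_inverse_commute)
      show ?thesis
      proof (intro exI[of _ "min d1 d2"] conjI allI impI)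
        fix h :: real assume h: "h \<noteq> 0 \<and> norm (h - 0) < min d1 d2"
        show "norm ((F (x + h) - F x) / h - f x) < e"
        proof (cases "h > 0")
          case True then show ?thesis using d1(2)[of h] h by auto
        next
          case False
          have "(F x - F (x - - h)) / - h = (F (x + h) - F x) / h" by (simp add: add.commute diff_divide_distrib)
          then show ?thesis using False d2(2)[of "-h"] h by auto
        qed
      qed (use d1 d2 in auto)
    qed
    then show "(F has_real_derivative f x) (at x)"
      unfolding DERIV_def by (intro LIM_I) auto
  qed
qed

section \<open>Almost everywhere differentiability of Lipschitz functions on the line\<close>

text \<open>Adding the linear function (L + 1) x raises all difference quotients from [-L, L] to
  [1, 2 L + 1]. The sum is therefore expanding and Lipschitz, hence the indefinite integral of a
  density, and subtracting the linear function again preserves differentiability.\<close>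

lemma Lipschitz_real_AE_differentiable:
  fixes F :: "real \<Rightarrow> real"
  assumes Lip: "L-lipschitz_on UNIV F"
  shows "negligible {x. \<not> F differentiable (at x)}"
proof -
  have L: "\<bar>F x - F y\<bar> \<le> L * \<bar>x - y\<bar>" for x y
    using lipschitz_onD[OF Lip] by (simp add: dist_real_def)
  define G where "G x = F x + (L + 1) * x" for x
  have G: "y - x \<le> G y - G x" "G y - G x \<le> (2 * L + 1) * (y - x)" if "x \<le> y" for x y
    using L[of x y] that by (auto simp: G_def algebra_simps abs_if split: if_splits)
  obtain f where "\<And>a b. a \<le> b \<Longrightarrow> (f has_integral (G b - G a)) {a..b}"
    using expanding_Lipschitz_has_density[of G "2 * L + 1"] G by blast
  then obtain N where N: "negligible N" "\<And>x. x \<notin> N \<Longrightarrow> (G has_real_derivative f x) (at x)"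
    using indefinite_integral_differentiable[of f G] by blast
  have "F differentiable (at x)" if "x \<notin> N" for x
  proof -
    have "((\<lambda>y. G y - (L + 1) * y) has_real_derivative (f x - (L + 1))) (at x)"
      by (rule derivative_eq_intros N(2)[OF that] | simp)+
    then show ?thesis by (auto simp: G_def real_differentiable_def)
  qed
  then show ?thesis by (intro negligible_subset[OF N(1)]) auto
qed

lemma Lipschitz_AE_differentiable:
  fixes F :: "real \<Rightarrow> 'a::euclidean_space"
  assumes Lip: "L-lipschitz_on UNIV F"
  shows "negligible {x. \<not> F differentiable (at x)}"
proof -
  have "L-lipschitz_on UNIV (\<lambda>x. F x \<bullet> i)" if "i \<in> Basis" for i
  proof (rule lipschitz_onI)
    show "dist (F x \<bullet> i) (F y \<bullet> i) \<le> L * dist x y" for x y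
      using lipschitz_onD[OF Lip, of x y] Basis_le_norm[OF that, of "F x - F y"]
      by (simp add: dist_norm inner_diff_left)
  qed (rule lipschitz_on_nonneg[OF Lip])
  then have "negligible (\<Union>i\<in>Basis. {x. \<not> (\<lambda>x. F x \<bullet> i) differentiable (at x)})"
    by (intro negligible_Union) (auto intro: Lipschitz_real_AE_differentiable)
  then show ?thesis
    by (rule negligible_subset) (use differentiable_componentwise_within[of F _ UNIV] in auto)
qed

section \<open>Radial limits\<close>

text \<open>Up to normalization, the Poisson kernel has mean 1. On the circle, |u - a|^2 = (u - a)
  (1 - cnj a u) / u, so the integral is Cauchy's formula at \<open>a\<close> for 1 / (1 - cnj a u),
  which has no pole in the closed disk.\<close>

lemma has_integral_inverse_dist_cis:
  assumes a: "norm a < 1"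
  shows "((\<lambda>t. 1 / (norm (cis t - a))\<^sup>2) has_integral 2 * pi / (1 - (norm a)\<^sup>2)) {0..2 * pi}"
proof -
  have nz: "1 - cnj a * u \<noteq> 0" if "norm u \<le> 1" for u
  proof -
    have "norm (cnj a * u) < 1" using that a mult_left_le[of "norm u" "norm a"] by (simp add: norm_mult)
    then show ?thesis by (metis norm_one order_less_irrefl eq_iff_diff_eq_0)
  qed
  have "((\<lambda>u. (1 / (1 - cnj a * u)) / (u - a)) has_contour_integral
      2 * of_real pi * \<i> * (1 / (1 - cnj a * a))) (circlepath 0 1)"
    using a nz by (intro Cauchy_integral_circlepath continuous_intros holomorphic_intros) auto
  then have "((\<lambda>t. (1 / (1 - cnj a * cis t)) / (cis t - a) * \<i> * cis t) has_integral
      2 * of_real pi * \<i> * (1 / (1 - cnj a * a))) {0..2 * pi}"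
    by (simp add: circlepath_def has_contour_integral_part_circlepath_iff)
  moreover have "(1 / (1 - cnj a * cis t)) / (cis t - a) * \<i> * cis t = \<i> * of_real (1 / (norm (cis t - a))\<^sup>2)" for t
  proof -
    have "cnj (cis t) = 1 / cis t" by (simp add: cis_cnj cis_inverse[symmetric] inverse_eq_divide)
    then have "cnj (cis t - a) = (1 - cnj a * cis t) / cis t" by (simp add: field_simps)
    then have "of_real ((norm (cis t - a))\<^sup>2) = (cis t - a) * (1 - cnj a * cis t) / cis t"
      unfolding complex_norm_square by simp
    then show ?thesis by (simp del: of_real_power)
  qed
  moreover have "2 * of_real pi * \<i> * (1 / (1 - cnj a * a)) = \<i> * of_real (2 * pi / (1 - (norm a)\<^sup>2))"
  proof -
    have "1 - cnj a * a = of_real (1 - (norm a)\<^sup>2)"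
      by (simp only: of_real_diff complex_norm_square of_real_1 mult.commute)
    then show ?thesis by simp
  qed
  ultimately have "((\<lambda>t. \<i> * of_real (1 / (norm (cis t - a))\<^sup>2)) has_integral
      \<i> * of_real (2 * pi / (1 - (norm a)\<^sup>2))) {0..2 * pi}"
    by (simp only:)
  then have "((\<lambda>t. Im (\<i> * of_real (1 / (norm (cis t - a))\<^sup>2))) has_integral
      Im (\<i> * of_real (2 * pi / (1 - (norm a)\<^sup>2)))) {0..2 * pi}"
    using has_integral_linear[OF _ bounded_linear_Im, unfolded o_def] by blast
  then show ?thesis by simp
qed

text \<open>Subtracting the pole at the reflected point \<open>1 / r\<close>, whose contribution to the Cauchy
  integral is zero, gains the factor \<open>1 - r\<close>.\<close>

lemma reflected_Cauchy_kernel_bound: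
  fixes w :: complex and r :: real
  assumes w: "norm w = 1" and r: "0 < r" "r < 1"
  shows "norm (1 / (w - of_real r)\<^sup>2 - 1 / (w - 1 / of_real r)\<^sup>2) \<le> 4 * (1 - r) / norm (w - of_real r) ^ 3"
proof -
  define D where "D = norm (w - of_real r)"
  have ne: "w \<noteq> of_real r" "w \<noteq> 1 / of_real r" using w r by (auto simp: norm_divide)
  then have D: "D > 0" by (simp add: D_def)
  \<comment> \<open>The points r and 1 / r are mirror images in the circle, so the distances of
    \<open>w\<close> to them have a fixed ratio: |w - 1 / r| = \<open>D / r\<close>. Everything can
    then be expressed by \<open>D\<close>.\<close>
  have "norm (of_real r - cnj w) = D"
    using complex_mod_cnj[of "w - of_real r"] by (simp add: D_def norm_minus_commute)
  moreover have "w * cnj w = 1" using w by (simp add: complex_norm_square[symmetric])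
  then have "w - 1 / of_real r = w * (of_real r - cnj w) / of_real r"
    using r by (simp add: field_simps)
  ultimately have Dr: "norm (w - 1 / of_real r) = D / r" using w r by (simp add: norm_mult norm_divide)
  have "1 / (w - of_real r)\<^sup>2 - 1 / (w - 1 / of_real r)\<^sup>2 =
      (of_real r - 1 / of_real r) * ((w - of_real r) + (w - 1 / of_real r)) / ((w - of_real r)\<^sup>2 * (w - 1 / of_real r)\<^sup>2)"
  proof -
    have "1 / p\<^sup>2 - 1 / q\<^sup>2 = (q - p) * (p + q) / (p\<^sup>2 * q\<^sup>2)" if "p \<noteq> 0" "q \<noteq> 0" for p q :: complex
      using that by (simp add: field_simps power2_eq_square)
    from this[of "w - of_real r" "w - 1 / of_real r"] ne show ?thesis by simp
  qed
  also have "norm \<dots> = norm (of_real r - 1 / of_real r :: complex) * norm ((w - of_real r) + (w - 1 / of_real r)) / (D\<^sup>2 * (D / r)\<^sup>2)"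
    by (simp add: norm_mult norm_divide norm_power Dr D_def)
  also have "\<dots> \<le> ((1 / r - r) * (D + D / r)) / (D\<^sup>2 * (D / r)\<^sup>2)"
  proof (intro divide_right_mono mult_mono)
    have "norm (of_real (r - 1 / r) :: complex) = \<bar>r - 1 / r\<bar>" by (rule norm_of_real)
    also have "\<dots> = 1 / r - r" using r by (simp add: abs_if field_simps) (smt (verit) mult_left_le)
    finally show "norm (of_real r - 1 / of_real r :: complex) \<le> 1 / r - r" by simp
    show "norm ((w - of_real r) + (w - 1 / of_real r)) \<le> D + D / r"
      using norm_triangle_ineq[of "w - of_real r" "w - 1 / of_real r"] by (simp add: Dr D_def)
    show "0 \<le> 1 / r - r" using r by (simp add: field_simps) (smt (verit) mult_left_le)
  qed auto
  also have "\<dots> = (1 - r) * (1 + r)\<^sup>2 / D ^ 3"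
    using r D by (simp add: field_simps power2_eq_square power3_eq_cube)
  also have "\<dots> \<le> (1 - r) * 4 / D ^ 3"
  proof -
    have "(1 + r)\<^sup>2 \<le> 2\<^sup>2" using r by (intro power_mono) auto
    then show ?thesis using r D by (intro divide_right_mono mult_left_mono) auto
  qed
  finally show ?thesis by (simp add: D_def mult.commute)
qed

section \<open>Radial limits of a derivative from boundary values\<close>

text \<open>In Cauchy's formula with the reflected kernel, let D = |w - r|. The kernel is at most 4
  (1 - r) / D^3 and |w - 1| <= 2 D. The linear term of the bound thus yields a multiple of (1 - r) /
  D^2, whose mean is controlled by the Poisson integral. The exponent 3 cancels D^3 exactly and
  leaves a term that vanishes as r tends to 1.\<close>

lemma deriv_radial_bound:
  fixes E :: "complex \<Rightarrow> complex"
  assumes cont: "continuous_on (cball 0 1) E" and hol: "E holomorphic_on ball 0 1"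
    and r: "0 < r" "r < 1"
    and bound: "\<And>w. norm w = 1 \<Longrightarrow> norm (E w) \<le> e * norm (w - 1) + C * norm (w - 1) ^ 3"
    and e: "e \<ge> 0" and C: "C \<ge> 0"
  shows "norm (deriv E (of_real r)) \<le> 8 * e + 32 * C * (1 - r)"
proof -
  define k where "k w = 1 / (w - of_real r)\<^sup>2 - 1 / (w - 1 / of_real r)\<^sup>2" for w :: complex
  have rb: "(of_real r :: complex) \<in> ball 0 1" using r by simp
  note C' = Cauchy_derivative_integral_circlepath[OF cont hol rb]
  have ne: "u \<noteq> 1 / of_real r" if "norm u \<le> 1" for u :: complex
    using that r by (auto simp: norm_divide)
  have "((\<lambda>u. E u / (u - of_real r)\<^sup>2) has_contour_integral (2 * of_real pi * \<i> * deriv E (of_real r))) (circlepath 0 1)"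
    using has_contour_integral_integral[OF C'(1)] DERIV_imp_deriv[OF C'(2)] by simp
  \<comment> \<open>The pole 1 / r lies outside the closed disk, so this term can be subtracted
    without changing the value of the integral.\<close>
  moreover have "((\<lambda>u. E u / (u - 1 / of_real r)\<^sup>2) has_contour_integral 0) (circlepath 0 1)"
  proof (rule Cauchy_theorem_disc[where K = "{}" and a = 0 and e = 1])
    show "continuous_on (cball 0 1) (\<lambda>u. E u / (u - 1 / of_real r)\<^sup>2)"
      using ne by (intro continuous_intros cont) auto
    have "(\<lambda>u. E u / (u - 1 / of_real r)\<^sup>2) holomorphic_on ball 0 1"
      using ne by (intro holomorphic_intros hol) auto
    then show "(\<lambda>u. E u / (u - 1 / of_real r)\<^sup>2) field_differentiable at x" if "x \<in> ball 0 1 - {}" for x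
      using that holomorphic_on_imp_differentiable_at open_ball by blast
  qed auto
  ultimately have "((\<lambda>u. E u * k u) has_contour_integral (2 * of_real pi * \<i> * deriv E (of_real r))) (circlepath 0 1)"
    using has_contour_integral_diff by (fastforce simp: k_def right_diff_distrib)
  then have I: "((\<lambda>t. E (cis t) * k (cis t) * \<i> * cis t) has_integral (2 * of_real pi * \<i> * deriv E (of_real r))) {0..2 * pi}"
    by (simp add: circlepath_def has_contour_integral_part_circlepath_iff)
  have J: "((\<lambda>t. 8 * e * (1 - r) * (1 / (norm (cis t - of_real r))\<^sup>2) + 32 * C * (1 - r)) has_integral
      (8 * e * (1 - r) * (2 * pi / (1 - r\<^sup>2)) + 32 * C * (1 - r) * (2 * pi))) {0..2 * pi}"
    using has_integral_const_real[of "32 * C * (1 - r)" 0 "2 * pi"] r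
    by (intro has_integral_add has_integral_mult_right)
       (use has_integral_inverse_dist_cis[of "of_real r"] in \<open>auto simp: mult.commute\<close>)
  have "norm (E (cis t) * k (cis t) * \<i> * cis t) \<le> 8 * e * (1 - r) * (1 / (norm (cis t - of_real r))\<^sup>2) + 32 * C * (1 - r)" for t
  proof -
    define D where "D = norm (cis t - of_real r)"
    have D0: "1 - r \<le> D" using norm_triangle_ineq2[of "cis t" "of_real r"] r by (simp add: D_def)
    then have D: "D > 0" using r by simp
    \<comment> \<open>|w - 1| <= D + (1 - r) for w = \<open>cis t\<close>, and 1 - r <= D by
      \<open>D0\<close>.\<close>
    have le: "norm (cis t - 1) \<le> 2 * D"
      using norm_triangle_ineq[of "cis t - of_real r" "of_real r - 1"] D0 r
        norm_of_real[of "r - 1", where 'a = complex] by (simp add: D_def)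
    have "norm (E (cis t) * k (cis t) * \<i> * cis t) = norm (E (cis t)) * norm (k (cis t))"
      by (simp add: norm_mult)
    also have "\<dots> \<le> (e * (2 * D) + C * (2 * D) ^ 3) * (4 * (1 - r) / D ^ 3)"
    proof (intro mult_mono)
      have "e * norm (cis t - 1) + C * norm (cis t - 1) ^ 3 \<le> e * (2 * D) + C * (2 * D) ^ 3"
        using le e C by (intro add_mono mult_left_mono power_mono) auto
      then show "norm (E (cis t)) \<le> e * (2 * D) + C * (2 * D) ^ 3"
        using bound[of "cis t"] by simp
      show "norm (k (cis t)) \<le> 4 * (1 - r) / D ^ 3"
        unfolding k_def D_def by (rule reflected_Cauchy_kernel_bound) (use r in auto)
    qed (use D e C in auto)
    also have "\<dots> = 8 * e * (1 - r) * (1 / D\<^sup>2) + 32 * C * (1 - r)"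
      using D by (simp add: field_simps power2_eq_square power3_eq_cube)
    finally show ?thesis by (simp add: D_def)
  qed
  then have "norm (integral {0..2 * pi} (\<lambda>t. E (cis t) * k (cis t) * \<i> * cis t)) \<le>
      integral {0..2 * pi} (\<lambda>t. 8 * e * (1 - r) * (1 / (norm (cis t - of_real r))\<^sup>2) + 32 * C * (1 - r))"
    using I J by (intro integral_norm_bound_integral) (auto simp: integrable_on_def)
  then have "2 * pi * norm (deriv E (of_real r)) \<le> 8 * e * (1 - r) * (2 * pi / (1 - r\<^sup>2)) + 32 * C * (1 - r) * (2 * pi)"
    unfolding integral_unique[OF I] integral_unique[OF J] by (simp add: norm_mult)
  also have "\<dots> = 2 * pi * (8 * e * ((1 - r) / (1 - r\<^sup>2)) + 32 * C * (1 - r))"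
    by (simp add: algebra_simps diff_divide_distrib)
  finally have "norm (deriv E (of_real r)) \<le> 8 * e * ((1 - r) / (1 - r\<^sup>2)) + 32 * C * (1 - r)"
    by (rule mult_left_le_imp_le) simp
  \<comment> \<open>The quotient is 1 / (1 + r).\<close>
  moreover have "(1 - r) / (1 - r\<^sup>2) \<le> 1"
    using r power_strict_mono[of r 1 2] power_decreasing[of 1 2 r] by simp
  then have "8 * e * ((1 - r) / (1 - r\<^sup>2)) \<le> 8 * e * 1" using e by (intro mult_left_mono) auto
  ultimately show ?thesis by simp
qed

text \<open>Differentiability at 1 is asked for along the circle only. After the affine part is
  subtracted, the remainder is small relative to |w - 1| near 1 and bounded by a multiple of |w -
  1|^3 elsewhere, so the radial bound applies and its cubic contribution dies out.\<close>

lemma deriv_tendsto_radially: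
  fixes B :: "complex \<Rightarrow> complex"
  assumes cont: "continuous_on (cball 0 1) B" and hol: "B holomorphic_on ball 0 1"
    and diff: "\<And>e. e > 0 \<Longrightarrow> \<exists>d>0. \<forall>w. norm w = 1 \<and> norm (w - 1) < d \<longrightarrow>
        norm (B w - B 1 - \<beta> * (w - 1)) \<le> e * norm (w - 1)"
  shows "((\<lambda>r. deriv B (of_real r)) \<longlongrightarrow> \<beta>) (at_left (1::real))"
proof (rule tendstoI)
  fix \<epsilon> :: real assume "\<epsilon> > 0"
  define E where "E w = B w - B 1 - \<beta> * (w - 1)" for w
  have contE: "continuous_on (cball 0 1) E" and holE: "E holomorphic_on ball 0 1"
    unfolding E_def by (intro continuous_intros holomorphic_intros cont hol)+
  \<comment> \<open>The radial bound tends to \<open>8 * e\<close>, which is then half of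
    \<open>\<epsilon>\<close>.\<close>
  define e where "e = \<epsilon> / 16"
  have "e > 0" using \<open>\<epsilon> > 0\<close> by (simp add: e_def)
  then obtain d where d: "d > 0" "\<And>w. norm w = 1 \<and> norm (w - 1) < d \<Longrightarrow> norm (E w) \<le> e * norm (w - 1)"
    using diff[of e] by (auto simp: E_def)
  have "bounded (E ` cball 0 1)"
    by (intro compact_imp_bounded compact_continuous_image contE compact_cball)
  then obtain M where M: "M > 0" "\<And>w. norm w \<le> 1 \<Longrightarrow> norm (E w) \<le> M"
    by (force simp: bounded_pos)
  \<comment> \<open>Where |w - 1| >= d, the cubic term alone exceeds the global bound
    \<open>M\<close>.\<close>
  define C where "C = M / d ^ 3"
  have C: "C \<ge> 0" using M d by (simp add: C_def)
  have bound: "norm (E w) \<le> e * norm (w - 1) + C * norm (w - 1) ^ 3" if "norm w = 1" for w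
  proof (cases "norm (w - 1) < d")
    case True
    then show ?thesis using d(2)[of w] that C by (smt (verit) mult_nonneg_nonneg norm_ge_zero zero_le_power)
  next
    case False
    then have "d ^ 3 \<le> norm (w - 1) ^ 3" using d by (intro power_mono) auto
    then have "M \<le> C * norm (w - 1) ^ 3"
      using d M by (simp add: C_def field_simps)
    moreover have "0 \<le> e * norm (w - 1)" using \<open>e > 0\<close> by simp
    ultimately show ?thesis using M(2)[of w] that by linarith
  qed
  have "((\<lambda>r. 8 * e + 32 * C * (1 - r)) \<longlongrightarrow> 8 * e + 32 * C * (1 - 1)) (at_left (1::real))"
    by (intro tendsto_intros)
  moreover have "8 * e + 32 * C * (1 - 1) < \<epsilon>" using \<open>\<epsilon> > 0\<close> by (simp add: e_def)
  ultimately have "eventually (\<lambda>r. 8 * e + 32 * C * (1 - r) < \<epsilon>) (at_left (1::real))"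
    by (rule order_tendstoD(2))
  moreover have "eventually (\<lambda>r::real. r \<in> {0<..<1}) (at_left 1)"
    by (intro eventually_at_left_real) simp
  ultimately show "eventually (\<lambda>r. dist (deriv B (of_real r)) \<beta> < \<epsilon>) (at_left (1::real))"
  proof eventually_elim
    case (elim r)
    have "B field_differentiable at (of_real r)"
      using elim hol by (intro holomorphic_on_imp_differentiable_at[OF hol open_ball]) auto
    then have "(B has_field_derivative deriv B (of_real r)) (at (of_real r))"
      by (simp add: DERIV_deriv_iff_field_differentiable)
    then have "(E has_field_derivative deriv B (of_real r) - \<beta>) (at (of_real r))"
      unfolding E_def by (auto intro!: derivative_eq_intros)
    then have "deriv E (of_real r) = deriv B (of_real r) - \<beta>" by (rule DERIV_imp_deriv)
    then show ?case
      using deriv_radial_bound[OF contE holE _ _ bound _ C, of r] elim \<open>e > 0\<close> by (simp add: dist_norm)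
  qed
qed

section \<open>Angles, the circle measure and Fatou's theorem\<close>

lemma norm_cis_diff_le: "norm (cis s - cis t) \<le> \<bar>s - t\<bar>"
proof -
  have "cis s - cis t = cis t * (exp (\<i> * of_real (s - t)) - 1)"
    by (simp only: cis_conv_exp[symmetric] right_diff_distrib cis_mult) simp
  then have "norm (cis s - cis t) = 2 * \<bar>sin ((s - t) / 2)\<bar>"
    by (simp only: norm_mult dist_exp_i_1) simp
  also have "\<dots> \<le> \<bar>s - t\<bar>" using abs_sin_x_le_abs_x[of "(s - t) / 2"] by simp
  finally show ?thesis .
qed

text \<open>No measurability of \<open>P\<close> is assumed, so the image measure is first applied
  to a Borel condition: the principal argument \<open>Im (Ln \<zeta>)\<close> avoids a Borel null
  set covering \<open>N\<close>. This argument is an angle of \<open>\<zeta>\<close>, so the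
  condition implies \<open>P \<zeta>\<close>.\<close>

lemma AE_circle_measureI:
  assumes N: "negligible N" and P: "\<And>t. t \<notin> N \<Longrightarrow> P (cis t)"
  shows "AE \<zeta> in circle_measure. P \<zeta>"
proof -
  obtain N' where N': "N' \<in> null_sets lborel" "N \<subseteq> N'"
    using N by (metis negligible_iff_null_sets null_sets_completion_iff2)
  then have [measurable]: "N' \<in> sets borel" by auto
  have [measurable]: "(\<lambda>z. Im (Ln z)) \<in> borel_measurable borel" 
    by measurable
  have [measurable]: "cis \<in> borel_measurable borel"
    by (intro borel_measurable_continuous_onI continuous_intros)
  \<comment> \<open>The measure uses angles in [0, 2 pi), the principal argument lies in (-pi, pi].
    Hence both \<open>t\<close> and its translate by -2 pi have to avoid the null set.\<close>
  have Ln_cis: "Im (Ln (cis t)) \<in> {t, t - 2 * pi}" if "t \<in> {0..<2 * pi}" for t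
  proof (cases "t \<le> pi")
    case True
    have "- pi < t" using that pi_gt_zero by (simp add: less_le_trans)
    then show ?thesis using Arg_cis[of t] True by (simp add: Arg_eq_Im_Ln)
  next
    case False
    have "cis (t - 2 * pi) = cis t" by (simp add: complex_eq_iff cos_diff sin_diff)
    moreover have "Arg (cis (t - 2 * pi)) = t - 2 * pi" using False that by (intro Arg_cis) auto
    ultimately show ?thesis by (simp add: Arg_eq_Im_Ln)
  qed
  have AE1: "AE t in lborel. t \<notin> N'" using N'(1) by (rule AE_not_in)
  have "AE t in lborel. - 2 * pi + 1 * t \<notin> N'" by (rule AE_borel_affine[OF _ _ AE1]) auto
  with AE1 have "AE t in lborel. t \<in> {0..<2 * pi} \<longrightarrow> norm (cis t) = 1 \<and> Im (Ln (cis t)) \<notin> N'"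
  proof eventually_elim
    case (elim t)
    then show ?case using Ln_cis[of t] by auto
  qed
  then have "AE t in uniform_measure lborel {0..<2 * pi}. norm (cis t) = 1 \<and> Im (Ln (cis t)) \<notin> N'"
    by (intro AE_uniform_measureI) auto
  then have "AE \<zeta> in circle_measure. norm \<zeta> = 1 \<and> Im (Ln \<zeta>) \<notin> N'"
    unfolding circle_measure_def by (subst AE_distr_iff) auto
  then show ?thesis
  proof (rule AE_mp, intro AE_I2 impI)
    fix \<zeta> assume *: "norm \<zeta> = 1 \<and> Im (Ln \<zeta>) \<notin> N'"
    then have "cis (Im (Ln \<zeta>)) = \<zeta>"
      by (metis Arg_eq_Im_Ln cis_Arg norm_zero sgn_div_norm zero_neq_one inverse_1 scaleR_one)
    moreover have "Im (Ln \<zeta>) \<notin> N" using * N'(2) by blast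
    ultimately show "P \<zeta>" using P by metis
  qed
qed

theorem Fatou_radial_limit:
  assumes hol: "b holomorphic_on ball 0 1" and bound: "\<And>z. z \<in> ball 0 1 \<Longrightarrow> norm (b z) \<le> L"
  shows "AE \<zeta> in circle_measure. \<exists>w. has_radial_limit b \<zeta> w"
proof -
  have L: "L \<ge> 0" using order_trans[OF norm_ge_zero bound[of 0]] by simp
  obtain B where B: "\<And>z. z \<in> ball 0 1 \<Longrightarrow> (B has_field_derivative b z) (at z within ball 0 1)"
    using holomorphic_convex_primitive'[of "ball 0 1" b] hol by auto
  have "L-lipschitz_on (ball 0 1) B"
  proof (rule lipschitz_onI)
    show "dist (B x) (B y) \<le> L * dist x y" if "x \<in> ball 0 1" "y \<in> ball 0 1" for x y
      using field_differentiable_bound[of "ball 0 1" B b L x y] B bound that by (simp add: dist_norm)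
  qed (rule L)
  \<comment> \<open>\<open>B\<close> is controlled on the open disk only. Its Lipschitz extension
    \<open>A\<close> supplies boundary values and has the same derivative inside.\<close>
  then obtain A where "L-lipschitz_on (closure (ball 0 1)) A" and AB: "\<And>z. z \<in> ball 0 1 \<Longrightarrow> A z = B z"
    using lipschitz_extend_closure[of L "ball 0 1" B] by auto
  then have A: "L-lipschitz_on (cball 0 1) A" by simp
  have dA: "(A has_field_derivative b z) (at z)" if "z \<in> ball 0 1" for z
  proof (rule has_field_derivative_transform_within_open[OF _ open_ball that])
    show "(B has_field_derivative b z) (at z)" using B[OF that] at_within_open[OF that open_ball] by simp
  qed (simp add: AB)
  have "L-lipschitz_on UNIV (\<lambda>t. A (cis t))"
  proof (rule lipschitz_onI)
    fix s t
    have "dist (A (cis s)) (A (cis t)) \<le> L * dist (cis s) (cis t)" by (rule lipschitz_onD[OF A]) auto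
    also have "\<dots> \<le> L * dist s t"
      unfolding dist_norm real_norm_def by (rule mult_left_mono[OF norm_cis_diff_le L])
    finally show "dist (A (cis s)) (A (cis t)) \<le> L * dist s t" .
  qed (rule L)
  then have neg: "negligible {t. \<not> (\<lambda>t. A (cis t)) differentiable (at t)}"
    by (rule Lipschitz_AE_differentiable)
  show ?thesis
  proof (rule AE_circle_measureI[OF neg])
    fix t assume "t \<notin> {t. \<not> (\<lambda>t. A (cis t)) differentiable (at t)}"
    then obtain v where v: "((\<lambda>t. A (cis t)) has_vector_derivative v) (at t)"
      by (auto simp: vector_derivative_works)
    define \<zeta> where "\<zeta> = cis t"
    have \<zeta>: "norm \<zeta> = 1" "\<zeta> \<noteq> 0" by (auto simp: \<zeta>_def)
    \<comment> \<open>Along \<open>\<zeta> * cis s\<close> the chain rule at s = 0 suggests v = i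
      \<beta>, where \<beta> is the derivative of \<open>\<lambda>w. A (\<zeta> * w)\<close> at 1
      along the circle.\<close>
    define \<beta> where "\<beta> = - \<i> * v"
    have in_ball: "\<zeta> * z \<in> ball 0 1" if "z \<in> ball 0 1" for z
      using that \<zeta> by (simp add: norm_mult)
    have dC: "((\<lambda>w. A (\<zeta> * w)) has_field_derivative (b (\<zeta> * z) * \<zeta>)) (at z)" if "z \<in> ball 0 1" for z
      by (rule DERIV_chain2[where g = "\<lambda>w. \<zeta> * w", OF dA[OF in_ball[OF that]]])
         (auto intro!: derivative_eq_intros)
    \<comment> \<open>Rotation moves the boundary point to 1. The rotated function has derivative
      \<open>b (\<zeta> * w) * \<zeta>\<close>, which explains the later division by
      \<open>\<zeta>\<close>.\<close>
    have "((\<lambda>r. deriv (\<lambda>w. A (\<zeta> * w)) (of_real r)) \<longlongrightarrow> \<beta>) (at_left (1::real))"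
    proof (rule deriv_tendsto_radially)
      show "continuous_on (cball 0 1) (\<lambda>w. A (\<zeta> * w))"
        by (rule continuous_on_compose2[OF lipschitz_on_continuous_on[OF A]])
           (auto intro!: continuous_intros simp: norm_mult \<zeta>)
      show "(\<lambda>w. A (\<zeta> * w)) holomorphic_on ball 0 1"
        unfolding holomorphic_on_open[OF open_ball] using dC by blast
      fix e :: real assume "e > 0"
      \<comment> \<open>This is the first-order remainder as a function of the angle; its derivative
        at 0 vanishes by the choice of \<open>\<beta>\<close>. Composing with
        \<open>Im (Ln w)\<close>, which is differentiable at 1 and inverts \<open>cis\<close> on the
        circle, gives the remainder in terms of \<open>w\<close>.\<close>
      define \<psi> where "\<psi> s = A (cis (t + s)) - A \<zeta> - \<beta> * (cis s - 1)" for s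
      have "((\<lambda>s. t + s) has_vector_derivative 1) (at 0)"
        by (auto intro!: derivative_eq_intros)
      then have "((\<lambda>s. A (cis (t + s))) has_vector_derivative v) (at 0)"
        using vector_diff_chain_at[of "\<lambda>s. t + s" 1 0 "\<lambda>t. A (cis t)" v] v by (simp add: o_def)
      moreover have "(cis has_vector_derivative \<i>) (at 0)"
      proof -
        have "((\<lambda>z. exp (\<i> * z)) has_field_derivative \<i>) (at (of_real 0))"
          by (auto intro!: derivative_eq_intros)
        from has_vector_derivative_real_field[OF this] show ?thesis by (simp add: cis_conv_exp[abs_def])
      qed
      ultimately have "(\<psi> has_vector_derivative (v - 0) - \<beta> * (\<i> - 0)) (at 0)"
        unfolding \<psi>_def
        by (intro has_vector_derivative_diff has_vector_derivative_mult_right has_vector_derivative_const)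
      moreover have "(v - 0) - \<beta> * (\<i> - 0) = 0" by (simp add: \<beta>_def complex_eq_iff)
      ultimately have \<psi>: "(\<psi> has_derivative (\<lambda>h. 0)) (at (Im (Ln 1)))"
        by (simp add: has_vector_derivative_def)
      have "(Ln has_derivative (\<lambda>h. h)) (at 1)"
        using has_field_derivative_imp_has_derivative[OF has_field_derivative_Ln[of 1]]
        by (simp add: has_derivative_def)
      then have "((\<lambda>w. Im (Ln w)) has_derivative Im) (at 1)"
        by (rule has_derivative_Im)
      from has_derivative_compose[OF this \<psi>]
      have "((\<lambda>w. \<psi> (Im (Ln w))) has_derivative (\<lambda>h. 0)) (at 1)" .
      then obtain d where d: "d > 0" "\<And>w. norm (w - 1) < d \<Longrightarrow> norm (\<psi> (Im (Ln w)) - \<psi> (Im (Ln 1))) \<le> e * norm (w - 1)"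
        using \<open>e > 0\<close> unfolding has_derivative_at_alt by auto
      have "norm (A (\<zeta> * w) - A (\<zeta> * 1) - \<beta> * (w - 1)) \<le> e * norm (w - 1)" if "norm w = 1" "norm (w - 1) < d" for w
      proof -
        have "cis (Im (Ln w)) = w"
          using that by (metis Arg_eq_Im_Ln cis_Arg norm_zero sgn_div_norm zero_neq_one inverse_1 scaleR_one)
        then have "\<psi> (Im (Ln w)) - \<psi> (Im (Ln 1)) = A (\<zeta> * w) - A (\<zeta> * 1) - \<beta> * (w - 1)"
          by (simp add: \<psi>_def \<zeta>_def cis_mult[symmetric])
        then show ?thesis using d(2)[OF that(2)] by simp
      qed
      then show "\<exists>d>0. \<forall>w. norm w = 1 \<and> norm (w - 1) < d \<longrightarrow>
          norm (A (\<zeta> * w) - A (\<zeta> * 1) - \<beta> * (w - 1)) \<le> e * norm (w - 1)"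
        using d(1) by blast
    qed
    then have "((\<lambda>r. deriv (\<lambda>w. A (\<zeta> * w)) (of_real r) / \<zeta>) \<longlongrightarrow> \<beta> / \<zeta>) (at_left (1::real))"
      by (intro tendsto_intros \<zeta>)
    moreover have "eventually (\<lambda>r. deriv (\<lambda>w. A (\<zeta> * w)) (of_real r) / \<zeta> = b (of_real r * \<zeta>)) (at_left (1::real))"
    proof (rule eventually_mono[OF eventually_at_left_real[of 0 1]])
      fix r :: real assume "r \<in> {0<..<1}"
      then show "deriv (\<lambda>w. A (\<zeta> * w)) (of_real r) / \<zeta> = b (of_real r * \<zeta>)"
        using DERIV_imp_deriv[OF dC, of "of_real r"] \<zeta> by (simp add: mult.commute)
    qed simp
    ultimately have "((\<lambda>r. b (of_real r * \<zeta>)) \<longlongrightarrow> \<beta> / \<zeta>) (at_left (1::real))"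
      by (rule Lim_transform_eventually)
    then show "\<exists>w. has_radial_limit b (cis t) w"
      unfolding has_radial_limit_def \<zeta>_def by blast
  qed
qed

section \<open>Sampling sequences\<close>

lemma nn_integral_inverse_dist_circle:
  assumes a: "norm a < 1"
  shows "(\<integral>\<^sup>+\<zeta>. ennreal (1 / (norm (\<zeta> - a))\<^sup>2) \<partial>circle_measure) = ennreal (1 / (1 - (norm a)\<^sup>2))"
proof -
  let ?f = "\<lambda>t. 1 / (norm (cis t - a))\<^sup>2"
  have [measurable]: "cis \<in> borel_measurable borel"
    by (intro borel_measurable_continuous_onI continuous_intros)
  have "(?f has_integral 2 * pi / (1 - (norm a)\<^sup>2)) {0..<2 * pi}"
    by (rule has_integral_spike_set_eq[THEN iffD1, OF _ _ has_integral_inverse_dist_cis[OF a]]; rule negligible_subset[of "{2 * pi}"]) auto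
  then have "(\<integral>\<^sup>+t. indicator {0..<2 * pi} t * ?f t \<partial>lborel) = ennreal (2 * pi / (1 - (norm a)\<^sup>2))"
    by (intro nn_integral_has_integral_lebesgue) auto
  also have "(\<integral>\<^sup>+t. indicator {0..<2 * pi} t * ?f t \<partial>lborel) = (\<integral>\<^sup>+t. ennreal (?f t) * indicator {0..<2 * pi} t \<partial>lborel)"
    by (intro nn_integral_cong) (simp add: indicator_def)
  finally have "(\<integral>\<^sup>+t. ennreal (?f t) * indicator {0..<2 * pi} t \<partial>lborel) = ennreal (2 * pi / (1 - (norm a)\<^sup>2))" .
  moreover have "(norm a)\<^sup>2 < 1" using a by (simp add: abs_square_less_1)
  ultimately show ?thesis
    unfolding circle_measure_def
    by (simp add: nn_integral_distr nn_integral_uniform_measure divide_ennreal)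
qed

text \<open>Fatou's lemma bounds the integral of the lower limit of 1 - |b(r_k \<zeta>)|^2 by 0.
  Since radial limits exist almost everywhere, this lower limit is 1 - |w|^2 with w the radial
  limit.\<close>

lemma inner_functionI:
  fixes r :: "nat \<Rightarrow> real"
  assumes b: "b \<in> Hinf_unit_ball" and r: "\<And>k. 0 < r k" "\<And>k. r k < 1" "r \<longlonglongrightarrow> 1"
    and lim: "(\<lambda>k. \<integral>\<^sup>+\<zeta>. indicator (sphere 0 1) \<zeta> * ennreal (1 - (norm (b (of_real (r k) * \<zeta>)))\<^sup>2) \<partial>circle_measure)
      \<longlonglongrightarrow> 0"
  shows "inner_function b"
proof -
  have hol: "b holomorphic_on unit_disk" and bound: "\<And>z. z \<in> unit_disk \<Longrightarrow> norm (b z) \<le> 1"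
    using b by (auto simp: Hinf_unit_ball_def)
  define h where "h k \<zeta> = indicator (sphere 0 1) \<zeta> * ennreal (1 - (norm (b (of_real (r k) * \<zeta>)))\<^sup>2)" for k \<zeta>
  have meas: "h k \<in> borel_measurable circle_measure" for k
  proof -
    have "continuous_on (sphere 0 1) (\<lambda>\<zeta>. 1 - (norm (b (of_real (r k) * \<zeta>)))\<^sup>2)"
      by (intro continuous_intros continuous_on_compose2[OF holomorphic_on_imp_continuous_on[OF hol]])
         (use r in \<open>auto simp: norm_mult less_imp_le\<close>)
    then have "(\<lambda>\<zeta>. indicator (sphere 0 1) \<zeta> *\<^sub>R (1 - (norm (b (of_real (r k) * \<zeta>)))\<^sup>2)) \<in> borel_measurable borel"
      by (intro borel_measurable_continuous_on_indicator) auto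
    then have "(\<lambda>\<zeta>. ennreal (indicator (sphere 0 1) \<zeta> *\<^sub>R (1 - (norm (b (of_real (r k) * \<zeta>)))\<^sup>2))) \<in> borel_measurable borel"
      by measurable
    also have "(\<lambda>\<zeta>. ennreal (indicator (sphere 0 1) \<zeta> *\<^sub>R (1 - (norm (b (of_real (r k) * \<zeta>)))\<^sup>2))) = h k"
      by (auto simp: h_def indicator_def fun_eq_iff)
    finally show ?thesis by (simp add: circle_measure_def)
  qed
  have "(\<integral>\<^sup>+\<zeta>. liminf (\<lambda>k. h k \<zeta>) \<partial>circle_measure) \<le> liminf (\<lambda>k. \<integral>\<^sup>+\<zeta>. h k \<zeta> \<partial>circle_measure)"
    by (rule nn_integral_liminf) (rule meas)
  also have "\<dots> = 0" using lim unfolding h_def by (intro lim_imp_Liminf) auto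
  finally have "(\<integral>\<^sup>+\<zeta>. liminf (\<lambda>k. h k \<zeta>) \<partial>circle_measure) = 0" by simp
  then have "AE \<zeta> in circle_measure. liminf (\<lambda>k. h k \<zeta>) = 0"
    using meas by (subst (asm) nn_integral_0_iff_AE) auto
  moreover have "AE \<zeta> in circle_measure. norm \<zeta> = 1"
    by (rule AE_circle_measureI[of "{}"]) auto
  moreover have "AE \<zeta> in circle_measure. \<exists>w. has_radial_limit b \<zeta> w"
    using Fatou_radial_limit[OF hol bound] by simp
  ultimately have "AE \<zeta> in circle_measure. \<exists>w. has_radial_limit b \<zeta> w \<and> norm w = 1"
  proof eventually_elim
    case (elim \<zeta>)
    then obtain w where w: "has_radial_limit b \<zeta> w" by blast
    have "filterlim r (at_left 1) sequentially"
      using r less_imp_neq[OF r(2)] by (auto simp: filterlim_at)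
    with w have lim_b: "(\<lambda>k. b (of_real (r k) * \<zeta>)) \<longlonglongrightarrow> w"
      unfolding has_radial_limit_def by (rule filterlim_compose)
    have "norm (b (of_real (r k) * \<zeta>)) \<le> 1" for k
      using r elim by (intro bound) (auto simp: norm_mult less_imp_le)
    then have "norm w \<le> 1"
      by (intro LIMSEQ_le_const2[OF tendsto_norm[OF lim_b]]) auto
    have "(\<lambda>k. h k \<zeta>) \<longlonglongrightarrow> ennreal (1 - (norm w)\<^sup>2)"
      using elim unfolding h_def by (auto intro!: tendsto_intros lim_b)
    then have "liminf (\<lambda>k. h k \<zeta>) = ennreal (1 - (norm w)\<^sup>2)"
      by (intro lim_imp_Liminf) auto
    \<comment> \<open>\<open>ennreal\<close> truncates negative reals to 0, so a zero value yields
      only |w| >= 1; the opposite inequality is inherited from the bound on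
      \<open>b\<close>.\<close>
    then have "1 \<le> (norm w)\<^sup>2" using elim by (simp add: ennreal_eq_0_iff)
    then have "1 \<le> norm w" using power2_le_imp_le[of 1 "norm w"] by simp
    with w \<open>norm w \<le> 1\<close> show ?case by auto
  qed
  then show ?thesis using b by (simp add: inner_function_def)
qed

text \<open>By the maximum modulus principle \<open>b\<close> is a unimodular constant. This settles
  the degenerate case, so that |b| < 1 may be assumed when the sampling inequality is
  tested.\<close>

lemma inner_function_unimodular_value:
  assumes b: "b \<in> Hinf_unit_ball" and z: "z \<in> unit_disk" "norm (b z) = 1"
  shows "inner_function b"
proof -
  have hol: "b holomorphic_on unit_disk" and bound: "\<And>z. z \<in> unit_disk \<Longrightarrow> norm (b z) \<le> 1"
    using b by (auto simp: Hinf_unit_ball_def)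
  have "b constant_on unit_disk"
    using maximum_modulus_principle[OF hol _ _ _ order_refl z(1)] bound z by auto
  then have const: "b u = b z" if "u \<in> unit_disk" for u using that z(1) by (auto simp: constant_on_def)
  have "has_radial_limit b \<zeta> (b z)" if "norm \<zeta> = 1" for \<zeta>
    unfolding has_radial_limit_def
  proof (rule Lim_transform_eventually[OF tendsto_const])
    show "eventually (\<lambda>r. b z = b (of_real r * \<zeta>)) (at_left (1::real))"
      using that by (intro eventually_mono[OF eventually_at_left_real[of 0 1]]) (auto simp: norm_mult const)
  qed
  then have "AE \<zeta> in circle_measure. \<exists>w. has_radial_limit b \<zeta> w \<and> norm w = 1"
    by (intro AE_circle_measureI[of "{}"]) (use z in \<open>auto intro!: exI[of _ "b z"]\<close>)
  with b show ?thesis by (simp add: inner_function_def)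
qed

section \<open>Testing the sampling inequality on kernel functions\<close>

lemma dBR_kernel_ip_norm:
  assumes "de_Branges_Rovnyak_space b H ip" and w: "w \<in> unit_disk"
  shows "(ip_norm ip (dBR_kernel b w))\<^sup>2 = (1 - (norm (b w))\<^sup>2) / (1 - (norm w)\<^sup>2)"
proof -
  interpret reproducing_kernel_hilbert_space unit_disk H ip "dBR_kernel b"
    using assms by (simp add: de_Branges_Rovnyak_space_def)
  have "(ip_norm ip (dBR_kernel b w))\<^sup>2 = Re (dBR_kernel b w w)"
    using ip_nonneg[OF kernel_mem[OF w]] reproducing[OF kernel_mem[OF w] w] by (simp add: ip_norm_def)
  also have "dBR_kernel b w w = of_real ((1 - (norm (b w))\<^sup>2) / (1 - (norm w)\<^sup>2))"
    using w unfolding dBR_kernel_def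
    by (simp only: of_real_divide of_real_diff complex_norm_square of_real_1 mult.commute if_True)
  finally show ?thesis by simp
qed

text \<open>Multiplication by the unimodular \<open>\<zeta>\<close> turns the denominator of the
  kernel at r \<zeta> into a distance from \<open>\<zeta>\<close>, the form whose circle mean is
  known.\<close>

lemma norm_one_minus_cnj_mult_circle:
  assumes "norm \<zeta> = 1"
  shows "norm (1 - cnj (of_real r * \<zeta>) * z) = norm (\<zeta> - of_real r * z)"
proof -
  have "\<zeta> * cnj \<zeta> = 1" using assms by (simp add: complex_norm_square[symmetric])
  then have "\<zeta> * (1 - cnj (of_real r * \<zeta>) * z) = \<zeta> - of_real r * z"
    by (simp add: algebra_simps)
  then show ?thesis using assms by (metis mult_1 norm_mult)
qed

text \<open>The lower sampling inequality is applied to the kernel at r \<zeta>, whose squared norm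
  is (1 - |b(r \<zeta>)|^2) / (1 - r^2). The weights \<open>w\<close> depend on neither r nor
  \<zeta>. The bound is an \<open>ennreal\<close> series so that it can be integrated term by
  term.\<close>

lemma sampling_sequence_defect_bound:
  assumes b: "b \<in> Hinf_unit_ball" and H: "de_Branges_Rovnyak_space b H ip"
    and \<Lambda>: "sampling_sequence b H ip \<Lambda>" and b_lt: "\<And>z. z \<in> unit_disk \<Longrightarrow> norm (b z) < 1"
  obtains w where "summable w" "\<And>n. 0 \<le> (w n :: real)"
    "\<And>r \<zeta>. 0 < r \<Longrightarrow> r < 1 \<Longrightarrow> norm \<zeta> = 1 \<Longrightarrow>
      ennreal (1 - (norm (b (of_real r * \<zeta>)))\<^sup>2) \<le> (\<Sum>n. ennreal (w n * (1 - r\<^sup>2)) * ennreal (1 / (norm (\<zeta> - of_real r * \<Lambda> n))\<^sup>2))"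
proof -
  interpret reproducing_kernel_hilbert_space unit_disk H ip "dBR_kernel b"
    using H by (simp add: de_Branges_Rovnyak_space_def)
  have \<Lambda>_disk: "\<Lambda> n \<in> unit_disk" for n using \<Lambda> unfolding sampling_sequence_def by blast
  define v where "v n = 1 / (ip_norm ip (dBR_kernel b (\<Lambda> n)))\<^sup>2" for n
  obtain c where c: "c > 0" "\<And>f. f \<in> H \<Longrightarrow> summable (\<lambda>n. v n * (norm (f (\<Lambda> n)))\<^sup>2)"
    "\<And>f. f \<in> H \<Longrightarrow> c * (ip_norm ip f)\<^sup>2 \<le> (\<Sum>n. v n * (norm (f (\<Lambda> n)))\<^sup>2)"
    using \<Lambda> by (auto simp: sampling_sequence_def Let_def v_def)
  have v_nonneg: "v n \<ge> 0" for n by (simp add: v_def)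
  \<comment> \<open>A lower bound, uniform in n, for |k_0(\<lambda>_n)| = |1 - cnj (b 0)
    b(\<lambda>_n)|. It transfers summability from the sampling sum of k_0 to the weights.\<close>
  define \<delta> where "\<delta> = 1 - norm (b 0)"
  have "\<delta> > 0" using b_lt[of 0] by (simp add: \<delta>_def)
  have "summable v"
  proof (rule summable_comparison_test')
    show "summable (\<lambda>n. v n * (norm (dBR_kernel b 0 (\<Lambda> n)))\<^sup>2 / \<delta>\<^sup>2)"
      by (intro summable_divide c kernel_mem) simp
    fix n
    have "norm (cnj (b 0) * b (\<Lambda> n)) \<le> norm (b 0) * 1"
      unfolding norm_mult complex_mod_cnj using b_lt[OF \<Lambda>_disk] by (intro mult_left_mono) (auto simp: less_imp_le)
    then have "\<delta> \<le> norm (1 - cnj (b 0) * b (\<Lambda> n))"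
      using norm_triangle_ineq2[of 1 "cnj (b 0) * b (\<Lambda> n)"] by (simp add: \<delta>_def)
    also have "1 - cnj (b 0) * b (\<Lambda> n) = dBR_kernel b 0 (\<Lambda> n)"
      using \<Lambda>_disk[of n] by (simp add: dBR_kernel_def)
    finally have "\<delta>\<^sup>2 \<le> (norm (dBR_kernel b 0 (\<Lambda> n)))\<^sup>2" using \<open>\<delta> > 0\<close> by (intro power_mono) auto
    then show "norm (v n) \<le> v n * (norm (dBR_kernel b 0 (\<Lambda> n)))\<^sup>2 / \<delta>\<^sup>2"
      using v_nonneg[of n] \<open>\<delta> > 0\<close> by (simp add: field_simps mult_left_mono)
  qed
  show ?thesis
  proof
    \<comment> \<open>The 4 is the square of the bound 2 for the kernel's numerator, and
      \<open>c\<close> is the lower sampling constant.\<close>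
    show "summable (\<lambda>n. 4 / c * v n)" using \<open>summable v\<close> by (rule summable_mult)
    show "0 \<le> 4 / c * v n" for n using v_nonneg c(1) by simp
    fix r :: real and \<zeta> :: complex assume r: "0 < r" "r < 1" and \<zeta>: "norm \<zeta> = 1"
    define z where "z = of_real r * \<zeta>"
    have z: "z \<in> unit_disk" "norm z = r" using r \<zeta> by (auto simp: z_def norm_mult)
    have r2: "1 - r\<^sup>2 > 0" using r by (simp add: abs_square_less_1)
    have kernel_le: "(norm (dBR_kernel b z (\<Lambda> n)))\<^sup>2 \<le> 4 * (1 / (norm (\<zeta> - of_real r * \<Lambda> n))\<^sup>2)" for n
    proof -
      have "norm (cnj (b z) * b (\<Lambda> n)) \<le> 1"
        unfolding norm_mult complex_mod_cnj using b_lt[OF \<Lambda>_disk] b_lt[OF z(1)] by (intro mult_le_one) (auto simp: less_imp_le)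
      then have "norm (1 - cnj (b z) * b (\<Lambda> n)) \<le> 2"
        using norm_triangle_ineq4[of 1 "cnj (b z) * b (\<Lambda> n)"] by simp
      then have "(norm (1 - cnj (b z) * b (\<Lambda> n)))\<^sup>2 \<le> 2\<^sup>2" by (intro power_mono) auto
      moreover have "norm (dBR_kernel b z (\<Lambda> n)) = norm (1 - cnj (b z) * b (\<Lambda> n)) / norm (\<zeta> - of_real r * \<Lambda> n)"
        using \<Lambda>_disk[of n] norm_one_minus_cnj_mult_circle[OF \<zeta>, of r "\<Lambda> n"]
        by (simp add: dBR_kernel_def norm_divide z_def)
      ultimately show ?thesis by (simp add: power_divide divide_right_mono)
    qed
    have "c * (ip_norm ip (dBR_kernel b z))\<^sup>2 \<le> (\<Sum>n. v n * (norm (dBR_kernel b z (\<Lambda> n)))\<^sup>2)"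
      by (intro c kernel_mem z)
    then have "1 - (norm (b z))\<^sup>2 \<le> (1 - r\<^sup>2) / c * (\<Sum>n. v n * (norm (dBR_kernel b z (\<Lambda> n)))\<^sup>2)"
      using c(1) r2 by (simp add: dBR_kernel_ip_norm[OF H z(1)] z(2) field_simps)
    also have "\<dots> = (\<Sum>n. (1 - r\<^sup>2) / c * (v n * (norm (dBR_kernel b z (\<Lambda> n)))\<^sup>2))"
      by (intro suminf_mult[symmetric] c kernel_mem z)
    finally have "ennreal (1 - (norm (b z))\<^sup>2) \<le> ennreal (\<Sum>n. (1 - r\<^sup>2) / c * (v n * (norm (dBR_kernel b z (\<Lambda> n)))\<^sup>2))"
      by (rule ennreal_leI)
    also have "\<dots> = (\<Sum>n. ennreal ((1 - r\<^sup>2) / c * (v n * (norm (dBR_kernel b z (\<Lambda> n)))\<^sup>2)))"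
      using r2 c(1) v_nonneg by (intro suminf_ennreal2[symmetric] summable_mult c kernel_mem z) auto
    also have "\<dots> \<le> (\<Sum>n. ennreal (4 / c * v n * (1 - r\<^sup>2)) * ennreal (1 / (norm (\<zeta> - of_real r * \<Lambda> n))\<^sup>2))"
    proof (intro suminf_le allI)
      fix n
      have "(1 - r\<^sup>2) / c * (v n * (norm (dBR_kernel b z (\<Lambda> n)))\<^sup>2) \<le> (1 - r\<^sup>2) / c * (v n * (4 * (1 / (norm (\<zeta> - of_real r * \<Lambda> n))\<^sup>2)))"
        using r2 c(1) v_nonneg by (intro mult_left_mono kernel_le) auto
      also have "\<dots> = (4 / c * v n * (1 - r\<^sup>2)) * (1 / (norm (\<zeta> - of_real r * \<Lambda> n))\<^sup>2)" by simp
      finally show "ennreal ((1 - r\<^sup>2) / c * (v n * (norm (dBR_kernel b z (\<Lambda> n)))\<^sup>2)) \<le>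
          ennreal (4 / c * v n * (1 - r\<^sup>2)) * ennreal (1 / (norm (\<zeta> - of_real r * \<Lambda> n))\<^sup>2)"
        using r2 c(1) v_nonneg[of n] by (subst ennreal_mult[symmetric]) (auto intro!: ennreal_leI)
    qed auto
    finally show "ennreal (1 - (norm (b (of_real r * \<zeta>)))\<^sup>2) \<le>
        (\<Sum>n. ennreal (4 / c * v n * (1 - r\<^sup>2)) * ennreal (1 / (norm (\<zeta> - of_real r * \<Lambda> n))\<^sup>2))"
      by (simp add: z_def)
  qed
qed

section \<open>Decay of the circle means of the defect\<close>

text \<open>Dominated convergence for series: the factors multiplying \<open>w n\<close> lie in
  [0, 1] because |a n| < 1, so \<open>w\<close> dominates. For fixed n the numerator tends to 0
  while the denominator tends to 1 - |a n|^2 > 0.\<close>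

lemma weighted_defect_sum_tendsto_0:
  fixes w :: "nat \<Rightarrow> real" and r :: "nat \<Rightarrow> real"
  assumes w: "summable w" "\<And>n. 0 \<le> w n" and a: "\<And>n. norm (a n :: complex) < 1"
    and r: "\<And>k. 0 < r k" "\<And>k. r k < 1" "r \<longlonglongrightarrow> 1"
  shows "\<And>k. summable (\<lambda>n. w n * (1 - (r k)\<^sup>2) / (1 - (r k * norm (a n))\<^sup>2))" (is "\<And>k. summable (?s k)")
    and "(\<lambda>k. \<Sum>n. w n * (1 - (r k)\<^sup>2) / (1 - (r k * norm (a n))\<^sup>2)) \<longlonglongrightarrow> 0"
proof -
  have le: "norm (?s k n) \<le> w n" for k n
  proof -
    have "r k * norm (a n) \<le> r k * 1" using r(1)[of k] a[of n] by (intro mult_left_mono) auto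
    then have "(r k * norm (a n))\<^sup>2 \<le> (r k)\<^sup>2" using r(1)[of k] by (intro power_mono) auto
    moreover have "(r k)\<^sup>2 < 1" using r(1,2)[of k] by (simp add: abs_square_less_1)
    ultimately have "0 \<le> (1 - (r k)\<^sup>2) / (1 - (r k * norm (a n))\<^sup>2)" "(1 - (r k)\<^sup>2) / (1 - (r k * norm (a n))\<^sup>2) \<le> 1"
      by auto
    then have "\<bar>w n * ((1 - (r k)\<^sup>2) / (1 - (r k * norm (a n))\<^sup>2))\<bar> \<le> w n * 1"
      unfolding abs_mult using w(2)[of n] by (intro mult_mono) (auto simp only: abs_of_nonneg)
    then show ?thesis by simp
  qed
  show "summable (?s k)" for k by (rule summable_comparison_test'[OF w(1) le])
  have "(\<lambda>k. ?s k n) \<longlonglongrightarrow> 0" for n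
  proof -
    have "(norm (a n))\<^sup>2 < 1" using a[of n] by (simp add: abs_square_less_1)
    then have "(\<lambda>k. ?s k n) \<longlonglongrightarrow> w n * (1 - 1\<^sup>2) / (1 - (1 * norm (a n))\<^sup>2)"
      by (intro tendsto_intros r) auto
    then show ?thesis by simp
  qed
  then have "(\<lambda>k. suminf (?s k)) \<longlonglongrightarrow> suminf (\<lambda>n. 0 :: real)"
    using tannerys_theorem[where a = "\<lambda>n k. ?s k n" and b = "\<lambda>_. 0" and F = sequentially and M = w] w(1) le
    by (auto intro!: always_eventually)
  then show "(\<lambda>k. suminf (?s k)) \<longlonglongrightarrow> 0" by simp
qed

theorem corollary4p19:
  fixes b :: "complex \<Rightarrow> complex"
    and H :: "(complex \<Rightarrow> complex) set"
    and ip :: "(complex \<Rightarrow> complex) \<Rightarrow> (complex \<Rightarrow> complex) \<Rightarrow> complex"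
  assumes "b \<in> Hinf_unit_ball"
    and "de_Branges_Rovnyak_space b H ip"
    and "\<exists>\<Lambda>. sampling_sequence b H ip \<Lambda>"
  shows "inner_function b"
proof (cases "\<exists>z\<in>unit_disk. norm (b z) = 1")
  case True
  then show ?thesis using inner_function_unimodular_value[OF assms(1)] by blast
next
  case False
  \<comment> \<open>Strictness makes 1 - |b 0| positive, which the summability of the weights rests
    on.\<close>
  then have b_lt: "norm (b z) < 1" if "z \<in> unit_disk" for z
    using that assms(1) by (force simp: Hinf_unit_ball_def order_less_le)
  obtain \<Lambda> where \<Lambda>: "sampling_sequence b H ip \<Lambda>" using assms(3) by blast
  then have \<Lambda>_lt: "norm (\<Lambda> n) < 1" for n by (force simp: sampling_sequence_def)
  obtain w where w: "summable w" "\<And>n. 0 \<le> (w n :: real)"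
    and defect: "\<And>r \<zeta>. 0 < r \<Longrightarrow> r < 1 \<Longrightarrow> norm \<zeta> = 1 \<Longrightarrow>
      ennreal (1 - (norm (b (of_real r * \<zeta>)))\<^sup>2) \<le> (\<Sum>n. ennreal (w n * (1 - r\<^sup>2)) * ennreal (1 / (norm (\<zeta> - of_real r * \<Lambda> n))\<^sup>2))"
    using sampling_sequence_defect_bound[OF assms(1,2) \<Lambda> b_lt] by blast
  \<comment> \<open>The shift by 2 keeps \<open>r 0\<close> = 1/2 positive.\<close>
  define r where "r k = 1 - 1 / real (k + 2)" for k
  have r: "0 < r k" "r k < 1" for k by (auto simp: r_def)
  have "(\<lambda>k. 1 / real (k + 2)) \<longlonglongrightarrow> 0"
    using LIMSEQ_ignore_initial_segment[OF lim_1_over_n, of 2] by simp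
  then have r_lim: "r \<longlonglongrightarrow> 1" unfolding r_def using tendsto_diff[OF tendsto_const[of 1]] by fastforce
  note sums = weighted_defect_sum_tendsto_0[OF w \<Lambda>_lt r r_lim]
  have le: "(\<integral>\<^sup>+\<zeta>. indicator (sphere 0 1) \<zeta> * ennreal (1 - (norm (b (of_real (r k) * \<zeta>)))\<^sup>2) \<partial>circle_measure)
      \<le> ennreal (\<Sum>n. w n * (1 - (r k)\<^sup>2) / (1 - (r k * norm (\<Lambda> n))\<^sup>2))" for k
  proof -
    have r2: "0 \<le> 1 - (r k)\<^sup>2" using r[of k] by (simp add: abs_square_le_1)
    have rn: "r k * norm (\<Lambda> n) < 1" for n
      using mult_strict_mono[OF r(2)[of k] \<Lambda>_lt[of n]] r[of k] by simp
    have meas: "(\<lambda>\<zeta>. ennreal (1 / (norm (\<zeta> - a))\<^sup>2)) \<in> borel_measurable circle_measure" for a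
      unfolding circle_measure_def by simp
    have "(\<integral>\<^sup>+\<zeta>. indicator (sphere 0 1) \<zeta> * ennreal (1 - (norm (b (of_real (r k) * \<zeta>)))\<^sup>2) \<partial>circle_measure)
        \<le> (\<integral>\<^sup>+\<zeta>. (\<Sum>n. ennreal (w n * (1 - (r k)\<^sup>2)) * ennreal (1 / (norm (\<zeta> - of_real (r k) * \<Lambda> n))\<^sup>2)) \<partial>circle_measure)"
      using defect[OF r] by (intro nn_integral_mono) (auto simp: indicator_def)
    \<comment> \<open>Sum and integral are exchanged by nonnegativity; each remaining integral is
      the Poisson mean for the point r_k \<lambda>_n.\<close>
    also have "\<dots> = (\<Sum>n. ennreal (w n * (1 - (r k)\<^sup>2)) * (\<integral>\<^sup>+\<zeta>. ennreal (1 / (norm (\<zeta> - of_real (r k) * \<Lambda> n))\<^sup>2) \<partial>circle_measure))"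
      using meas by (subst nn_integral_suminf) (auto intro!: suminf_cong nn_integral_cmult)
    also have "\<dots> = (\<Sum>n. ennreal (w n * (1 - (r k)\<^sup>2) / (1 - (r k * norm (\<Lambda> n))\<^sup>2)))"
    proof (intro suminf_cong)
      fix n
      have "(r k * norm (\<Lambda> n))\<^sup>2 < 1" using rn[of n] r(1)[of k] by (simp add: abs_square_less_1)
      then show "ennreal (w n * (1 - (r k)\<^sup>2)) * (\<integral>\<^sup>+\<zeta>. ennreal (1 / (norm (\<zeta> - of_real (r k) * \<Lambda> n))\<^sup>2) \<partial>circle_measure)
          = ennreal (w n * (1 - (r k)\<^sup>2) / (1 - (r k * norm (\<Lambda> n))\<^sup>2))"
        using rn[of n] r(1)[of k] r2 w(2)[of n]
        by (subst nn_integral_inverse_dist_circle) (auto simp: norm_mult ennreal_mult[symmetric])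
    qed
    also have "\<dots> = ennreal (\<Sum>n. w n * (1 - (r k)\<^sup>2) / (1 - (r k * norm (\<Lambda> n))\<^sup>2))"
    proof (intro suminf_ennreal2 sums(1))
      fix n
      have "(r k * norm (\<Lambda> n))\<^sup>2 < 1" using rn[of n] r(1)[of k] by (simp add: abs_square_less_1)
      then show "0 \<le> w n * (1 - (r k)\<^sup>2) / (1 - (r k * norm (\<Lambda> n))\<^sup>2)"
        using r2 w(2)[of n] by simp
    qed
    finally show ?thesis .
  qed
  have "(\<lambda>k. ennreal (\<Sum>n. w n * (1 - (r k)\<^sup>2) / (1 - (r k * norm (\<Lambda> n))\<^sup>2))) \<longlonglongrightarrow> ennreal 0"
    by (rule tendsto_ennrealI) (rule sums(2))
  then have "(\<lambda>k. \<integral>\<^sup>+\<zeta>. indicator (sphere 0 1) \<zeta> * ennreal (1 - (norm (b (of_real (r k) * \<zeta>)))\<^sup>2) \<partial>circle_measure) \<longlonglongrightarrow> 0"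
    unfolding ennreal_0
    by (rule tendsto_sandwich[OF _ _ tendsto_const, rotated 2]) (simp_all add: le)
  then show ?thesis by (rule inner_functionI[OF assms(1) r r_lim])
qed
end
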